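(* Let $s>0$, $\beta\in(0,1)$, integers $d\ge1$, $m\ge2$, and a differentiable $U:\mathbb R^d\to\mathbb R$ be given, together with points $(x_j^\circ)$, matrices $(H_j)$ and a constant $r_0>0$ satisfying Assumptions 1 and 2 of the context, and let $C,q,G_0,d_\circ,a$ be the constants defined in the context. Let $R\ge1$, $j\in\mathbb Z$, an integer $n\ge1$, $\varepsilon_0\ge0$, $\delta'>0$, let $U_R(x)=R^2U(x/R)$, and let $(Y_k)_{k\ge-1}$, $(\zeta_i)_{i\ge1}$ be $\mathbb R^d$-valued random sequences on a common probability space satisfying $$Y_{k+1}=(1+\beta)Y_k-\beta Y_{k-1}-s\nabla U_R(Y_k)+\zeta_{k+1},\qquad k\ge0.$$ Define $E_0=(Y_0-Rx_j^\circ,\ Y_{-1}-Rx_{j-1}^\circ)$ and the event $$\mathcal G=\{|E_0|\le\varepsilon_0R\}\cap\Bigl\{\max_{1\le i\le n}|\zeta_i|\le\delta'R\Bigr\}.$$ Assume $$C\varepsilon_0+G_0\delta'\le\frac a2 .$$ Then the following hold. (i) On $\mathcal G$, $|Y_k-Rx_{j+k}^\circ|\le aR/2$ for $0\le k\le n$. (ii) For each of the two consecutive indices $l\in\{j,j+1\}$ (with the same $R,n,\varepsilon_0,\delta'$), let $(Y_k^{(l)})_{k\ge-1}$ and $(\zeta_i^{(l)})_{i\ge1}$ be $\mathbb R^d$-valued random sequences on a common probability space satisfying $$Y_{k+1}^{(l)}=(1+\beta)Y_k^{(l)}-\beta Y_{k-1}^{(l)}-s\nabla U_R(Y_k^{(l)})+\zeta_{k+1}^{(l)},\qquad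 k\ge0,$$ and set $E_0^{(l)}=(Y_0^{(l)}-Rx_l^\circ,\ Y_{-1}^{(l)}-Rx_{l-1}^\circ)$ and $$\mathcal G_l=\{|E_0^{(l)}|\le\varepsilon_0R\}\cap\Bigl\{\max_{1\le i\le n}|\zeta_i^{(l)}|\le\delta'R\Bigr\}.$$ Then $$\|\mathrm{Law}(Y_n^{(j)})-\mathrm{Law}(Y_n^{(j+1)})\|_{\mathrm{TV}}\ge1-\mathbb P(\mathcal G_j^c)-\mathbb P(\mathcal G_{j+1}^c).$$ The same lower bound holds for the laws of random elements $Z_n^{(j)}$ and $Z_n^{(j+1)}$ if there is a common measurable map $f$ such that $Y_n^{(l)}=f(Z_n^{(l)})$ for $l\in\{j,j+1\}$. (iii) Suppose $E_0=0$ and $$\sup_{i\ge1}\mathbb P(|\zeta_i|>\delta'R)\le Ae^{-bR^2},$$ where $A,b>0$ are independent of $R$, $n$, and $i$. Then $\mathbb P(\mathcal G^c)\le Ane^{-bR^2}$. If the sequences with consecutive indices $j$ and $j+1$ both satisfy these assumptions, then $$\|\mathrm{Law}(Y_n^{(j)})-\mathrm{Law}(Y_n^{(j+1)})\|_{\mathrm{TV}}\ge1-2Ane^{-bR^2}.$$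
   Context: Assumption 1 (periodic orbit and local gradient identity): $(x_j^\circ)_{j\in\mathbb Z}$ is an $m$-periodic sequence in $\mathbb R^d$ with $x_0^\circ,\dots,x_{m-1}^\circ$ distinct, $(H_j)_{j\in\mathbb Z}$ is an $m$-periodic sequence of symmetric $d\times d$ matrices, and $r_0>0$, such that for every $j\in\mathbb Z$, $x_{j+1}^\circ=(1+\beta)x_j^\circ-\beta x_{j-1}^\circ-s\nabla U(x_j^\circ)$ and $\nabla U(x_j^\circ+u)=\nabla U(x_j^\circ)+H_ju$ for all $u\in\mathbb R^d$ with $|u|\le r_0$. Let $\mathsf A_j=\begin{pmatrix}(1+\beta)\mathrm{Id}_d-sH_j&-\beta\,\mathrm{Id}_d\\\mathrm{Id}_d&0\end{pmatrix}$ and $\mathsf B=\begin{pmatrix}\mathrm{Id}_d\\0\end{pmatrix}$. Assumption 2 (spectral radius condition): $\rho(\mathsf A_{m-1}\cdots\mathsf A_0)<1$, where $\rho$ is the spectral radius. For $j\in\mathbb Z$ and $0\le\ell<k$ let $\Psi_j(k,\ell)=\mathsf A_{j+k-1}\cdots\mathsf A_{j+\ell}$, and $\Psi_j(\ell,\ell)=\mathrm{Id}_{2d}$. Under the assumptions there are constants $C\ge1$ and $q\in(0,1)$ with $\|\Psi_j(k,\ell)\|\le Cq^{k-\ell}$ for all $j\in\mathbb Z$, $0\le\ell\le k$ (operator norm); fix such a pair $(C,q)$. Set $$G_0=\max_{0\le j<m}\sup_{k\ge1}\sum_{i=1}^k\|\Psi_j(k,i)\mathsf B\|\ \Bigl(\le\frac{C}{1-q}<\infty\Bigr),\qquad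 d_\circ=\min_{0\le j<m}|x_{j+1}^\circ-x_j^\circ|>0,\qquad a=\frac14\min\{r_0,d_\circ\}.$$ $|\cdot|$ is the Euclidean norm and $\|\nu-\widetilde\nu\|_{\mathrm{TV}}=\sup_A|\nu(A)-\widetilde\nu(A)|$. The noise variables $\zeta_i$ are not assumed independent. *)

theory Defs
  imports "HOL-Probability.Probability"
begin

definition gradient :: "('a::real_inner \<Rightarrow> real) \<Rightarrow> 'a \<Rightarrow> 'a" where
  "gradient U y = (THE g. GDERIV U y :> g)"

definition rescaled :: "real \<Rightarrow> ('a::real_vector \<Rightarrow> real) \<Rightarrow> 'a \<Rightarrow> real" where
  "rescaled R U y = R\<^sup>2 * U (y /\<^sub>R R)"

text \<open>In \<^typ>\<open>'a ^ 'c ^ 'r\<close> the row index is \<^typ>\<open>'r\<close>. The doubled dimension is encoded by the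
  index type \<^typ>\<open>'d + 'd\<close>, with \<^const>\<open>Inl\<close> for the first block and \<^const>\<open>Inr\<close> for the second.\<close>

definition block_matrix ::
    "'a ^ 'd ^ 'd \<Rightarrow> 'a ^ 'd ^ 'd \<Rightarrow> 'a ^ 'd ^ 'd \<Rightarrow> 'a ^ 'd ^ 'd
      \<Rightarrow> 'a ^ ('d::finite + 'd) ^ ('d + 'd)" where
  "block_matrix P Q S T = (\<chi> r c.
     case r of
       Inl i \<Rightarrow> (case c of Inl k \<Rightarrow> P $ i $ k | Inr k \<Rightarrow> Q $ i $ k)
     | Inr i \<Rightarrow> (case c of Inl k \<Rightarrow> S $ i $ k | Inr k \<Rightarrow> T $ i $ k))"

definition block_column :: "'a ^ 'd ^ 'd \<Rightarrow> 'a ^ 'd ^ 'd \<Rightarrow> 'a ^ 'd ^ ('d::finite + 'd)" where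
  "block_column P Q = (\<chi> r k. case r of Inl i \<Rightarrow> P $ i $ k | Inr i \<Rightarrow> Q $ i $ k)"

definition step_matrix ::
    "real \<Rightarrow> real \<Rightarrow> real ^ 'd ^ 'd \<Rightarrow> real ^ ('d::finite + 'd) ^ ('d + 'd)" where
  "step_matrix s \<beta> H = block_matrix (mat (1 + \<beta>) - s *\<^sub>R H) (mat (- \<beta>)) (mat 1) 0"

definition noise_matrix :: "real ^ 'd ^ ('d::finite + 'd)" where
  "noise_matrix = block_column (mat 1) 0"

text \<open>\<^term>\<open>transition A j k l\<close> is the ordered product of \<open>A (j+k-1)\<close>, ..., \<open>A (j+l)\<close>, with the
  largest index leftmost. It is the identity for \<open>k = l\<close>, and also (a junk value) for \<open>k < l\<close>.\<close>

primrec transition ::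
    "(int \<Rightarrow> real ^ 'n::finite ^ 'n) \<Rightarrow> int \<Rightarrow> nat \<Rightarrow> nat \<Rightarrow> real ^ 'n ^ 'n" where
  "transition A j 0 l = mat 1"
| "transition A j (Suc k) l =
     (if l \<le> k then A (j + int k) ** transition A j k l else mat 1)"

text \<open>Largest modulus of a complex eigenvalue of the real matrix \<open>M\<close>.\<close>

definition spectral_radius :: "real ^ 'n::finite ^ 'n \<Rightarrow> real" where
  "spectral_radius M =
     Max (cmod ` {z. \<exists>v. v \<noteq> 0 \<and> map_matrix complex_of_real M *v v = z *s v})"

definition opnorm :: "real ^ 'c::finite ^ 'r::finite \<Rightarrow> real" where
  "opnorm M = onorm ((*v) M)"

definition noise_gain :: "(int \<Rightarrow> real ^ ('d::finite + 'd) ^ ('d + 'd)) \<Rightarrow> nat \<Rightarrow> real" where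
  "noise_gain A m =
     (MAX j\<in>{0..<int m}. SUP k\<in>{1..}. \<Sum>i=1..k. opnorm (transition A j k i ** noise_matrix))"

definition orbit_gap :: "(int \<Rightarrow> 'a::real_normed_vector) \<Rightarrow> nat \<Rightarrow> real" where
  "orbit_gap x m = (MIN j\<in>{0..<int m}. norm (x (j + 1) - x j))"

definition tube_radius :: "(int \<Rightarrow> 'a::real_normed_vector) \<Rightarrow> nat \<Rightarrow> real \<Rightarrow> real" where
  "tube_radius x m r\<^sub>0 = 1/4 * min r\<^sub>0 (orbit_gap x m)"

text \<open>Only the values \<open>Y k\<close> with \<open>k \<ge> -1\<close> and \<open>\<zeta> i\<close> with \<open>i \<ge> 1\<close> matter.\<close>

definition noisy_heavy_ball ::
    "real \<Rightarrow> real \<Rightarrow> ('a::euclidean_space \<Rightarrow> real) \<Rightarrow> 'w measure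
      \<Rightarrow> (int \<Rightarrow> 'w \<Rightarrow> 'a) \<Rightarrow> (nat \<Rightarrow> 'w \<Rightarrow> 'a) \<Rightarrow> bool" where
  "noisy_heavy_ball s \<beta> V M Y \<zeta> \<longleftrightarrow>
     prob_space M \<and>
     (\<forall>k\<ge>-1. Y k \<in> borel_measurable M) \<and>
     (\<forall>i\<ge>1. \<zeta> i \<in> borel_measurable M) \<and>
     (\<forall>\<omega>\<in>space M. \<forall>k::nat.
        Y (int k + 1) \<omega> = (1 + \<beta>) *\<^sub>R Y (int k) \<omega> - \<beta> *\<^sub>R Y (int k - 1) \<omega>
          - s *\<^sub>R gradient V (Y (int k) \<omega>) + \<zeta> (k + 1) \<omega>)"

definition initial_error ::
    "(int \<Rightarrow> 'a::euclidean_space) \<Rightarrow> real \<Rightarrow> int \<Rightarrow> (int \<Rightarrow> 'w \<Rightarrow> 'a) \<Rightarrow> 'w \<Rightarrow> 'a \<times> 'a" where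
  "initial_error x R j Y \<omega> = (Y 0 \<omega> - R *\<^sub>R x j, Y (-1) \<omega> - R *\<^sub>R x (j - 1))"

definition good_event ::
    "(int \<Rightarrow> 'a::euclidean_space) \<Rightarrow> real \<Rightarrow> nat \<Rightarrow> real \<Rightarrow> real \<Rightarrow> int \<Rightarrow> 'w measure
      \<Rightarrow> (int \<Rightarrow> 'w \<Rightarrow> 'a) \<Rightarrow> (nat \<Rightarrow> 'w \<Rightarrow> 'a) \<Rightarrow> 'w set" where
  "good_event x R n \<epsilon>\<^sub>0 \<delta> j M Y \<zeta> =
     {\<omega> \<in> space M. norm (initial_error x R j Y \<omega>) \<le> \<epsilon>\<^sub>0 * R} \<inter>
     {\<omega> \<in> space M. (MAX i\<in>{1..n}. norm (\<zeta> i \<omega>)) \<le> \<delta> * R}"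

text \<open>Meant for probability measures on the same \<open>\<sigma>\<close>-algebra.\<close>

definition tv_dist :: "'a measure \<Rightarrow> 'a measure \<Rightarrow> real" where
  "tv_dist \<mu> \<nu> = (SUP S\<in>sets \<mu>. \<bar>measure \<mu> S - measure \<nu> S\<bar>)"

end

theory Submission
  imports Defs
begin

text \<open>
  The error \<open>e k = Y k - R *\<^sub>R x (j + k)\<close> of the noisy trajectory relative to the scaled orbit
  satisfies a linear recursion as long as it stays below \<open>r\<^sub>0 * R\<close>: near an orbit point the gradient of
  the rescaled potential is affine with the same linear part \<open>H\<close> for every \<open>R\<close>
  (\<open>gradient_rescaled_affine_near\<close>). Writing pairs of consecutive errors as one vector of doubled
  dimension turns this into \<open>E (k + 1) = A (j + k) *v E k + B *v \<zeta> (k + 1)\<close>, whose solution is the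
  transported initial error plus the transported noise (\<open>duhamel_formula\<close>). The first part is at
  most \<open>C * \<epsilon>\<^sub>0 * R\<close> by the decay of the products, the second at most \<open>G\<^sub>0 * \<delta> * R\<close> by the
  definition of the noise gain, so together they are at most \<open>a * R / 2\<close>. Since this is
  less than \<open>r\<^sub>0 * R\<close>, the linear recursion remains valid at the next step and an induction on time closes
  the argument (\<open>locally_linear_recursion_bounded\<close>, \<open>heavy_ball_shadows_orbit\<close>).

  Two trajectories started one phase apart are therefore confined at time \<open>n\<close>, each on its own
  good event, to balls of radius \<open>a * R / 2\<close> around two consecutive points of the scaled orbit. These
  centres are at least \<open>4 * a * R\<close> apart, so the balls are disjoint, and the first
  ball as a test set separates the two laws up to the probabilities that the good events fail. Pulling that ball back along \<open>f\<close> gives the same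
  bound for any random elements of which the positions are functions
  (\<open>tv_dist_ge_of_disjoint_confinement\<close>). For a vanishing initial error the good event fails only if
  one of \<open>n\<close> noise variables is large, which the union bound controls (\<open>measure_compl_good_event_le\<close>).
\<close>

section \<open>Gradients under rescaling\<close>

lemma gradient_eqI:
  fixes V :: "'a::real_inner \<Rightarrow> real"
  assumes "GDERIV V y :> g"
  shows "gradient V y = g"
  unfolding gradient_def
proof (rule the_equality)
  fix g' assume "GDERIV V y :> g'"
  then have "(\<lambda>h. h \<bullet> g') = (\<lambda>h. h \<bullet> g)"
    using assms unfolding gderiv_def by (rule has_derivative_unique)
  then show "g' = g"
    by (metis vector_eq_ldot)
qed (fact assms)

lemma GDERIV_gradient:
  fixes V :: "'a::euclidean_space \<Rightarrow> real"
  assumes "V differentiable (at y)"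
  shows "GDERIV V y :> gradient V y"
proof -
  obtain D where D: "(V has_derivative D) (at y)"
    using assms unfolding differentiable_def by blast
  \<comment> \<open>the adjoint of a functional, evaluated at 1, is its Riesz representative\<close>
  have "D = (\<lambda>h. h \<bullet> adjoint D 1)"
    using adjoint_works[OF has_derivative_linear[OF D], of _ 1] by (intro ext) simp
  then have "GDERIV V y :> adjoint D 1"
    using D unfolding gderiv_def by metis
  then show ?thesis
    using gradient_eqI by metis
qed

lemma gradient_rescaled:
  fixes U :: "'a::euclidean_space \<Rightarrow> real"
  assumes "U differentiable (at (y /\<^sub>R R))" and "R \<noteq> 0"
  shows "gradient (rescaled R U) y = R *\<^sub>R gradient U (y /\<^sub>R R)"
proof (rule gradient_eqI)
  let ?g = "gradient U (y /\<^sub>R R)"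
  have U: "(U has_derivative (\<lambda>h. h \<bullet> ?g)) (at (y /\<^sub>R R))"
    using GDERIV_gradient[OF assms(1)] unfolding gderiv_def .
  have "((\<lambda>y. y /\<^sub>R R) has_derivative (\<lambda>h. h /\<^sub>R R)) (at y)"
    by (auto intro!: derivative_eq_intros)
  from has_derivative_compose[OF this U]
  have "((\<lambda>y. R\<^sup>2 * U (y /\<^sub>R R)) has_derivative (\<lambda>h. R\<^sup>2 * ((h /\<^sub>R R) \<bullet> ?g))) (at y)"
    by (rule has_derivative_mult_right)
  moreover have "(\<lambda>h. R\<^sup>2 * ((h /\<^sub>R R) \<bullet> ?g)) = (\<lambda>h. h \<bullet> (R *\<^sub>R ?g))"
    using assms(2) by (auto simp: fun_eq_iff power2_eq_square)
  ultimately show "GDERIV (rescaled R U) y :> R *\<^sub>R ?g"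
    unfolding gderiv_def rescaled_def[abs_def] by simp
qed

text \<open>The quadratic factor in the rescaling makes the gradient affine with an unchanged linear part,
  while the region of validity is blown up by the factor \<open>R\<close>. This is why the linearised error
  dynamics, and with it \<open>C\<close>, \<open>q\<close> and the noise gain, do not depend on \<open>R\<close>.\<close>

lemma gradient_rescaled_affine_near:
  fixes U :: "real ^ 'd \<Rightarrow> real"
  assumes "\<forall>y. U differentiable (at y)" and "R > 0"
    and "\<forall>u. norm u \<le> r \<longrightarrow> gradient U (p + u) = gradient U p + K *v u"
    and "norm (y - R *\<^sub>R p) \<le> r * R"
  shows "gradient (rescaled R U) y = R *\<^sub>R gradient U p + K *v (y - R *\<^sub>R p)"
proof -
  define u where "u = (y - R *\<^sub>R p) /\<^sub>R R"
  have y: "y /\<^sub>R R = p + u"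
    using assms(2) unfolding u_def by (simp add: algebra_simps)
  have "norm u = norm (y - R *\<^sub>R p) / R"
    using assms(2) unfolding u_def by (simp add: divide_inverse mult.commute)
  then have "norm u \<le> r"
    using assms(2,4) by (simp add: pos_divide_le_eq)
  then have "gradient (rescaled R U) y = R *\<^sub>R (gradient U p + K *v u)"
    using gradient_rescaled[where U = U and y = y and R = R] assms(1-3) y by simp
  also have "\<dots> = R *\<^sub>R gradient U p + R *\<^sub>R (K *v u)"
    by (rule scaleR_add_right)
  also have "R *\<^sub>R (K *v u) = K *v (y - R *\<^sub>R p)"
    using assms(2) unfolding u_def by (simp add: matrix_vector_mult_scaleR)
  finally show ?thesis .
qed

section \<open>The recursion as a first order system in doubled dimension\<close>

text \<open>The vector counterpart of \<^const>\<open>block_matrix\<close>, isometric to the product norm in which the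
  initial error is measured.\<close>

definition stack :: "'a ^ 'd \<Rightarrow> 'a ^ 'd \<Rightarrow> 'a ^ ('d::finite + 'd)" where
  "stack u v = (\<chi> r. case r of Inl i \<Rightarrow> u $ i | Inr i \<Rightarrow> v $ i)"

lemma sum_UNIV_Plus:
  fixes f :: "'b::finite + 'c::finite \<Rightarrow> 'a::comm_monoid_add"
  shows "sum f UNIV = (\<Sum>i\<in>UNIV. f (Inl i)) + (\<Sum>i\<in>UNIV. f (Inr i))"
  by (simp add: UNIV_Plus_UNIV[symmetric] sum.Plus del: UNIV_Plus_UNIV)

lemma norm_stack: "norm (stack u v) = norm (u, v)"
  for u v :: "real ^ 'd"
  by (simp add: norm_vec_def L2_set_def stack_def sum_UNIV_Plus norm_prod_def sum_nonneg)

lemma norm_le_norm_stack: "norm u \<le> norm (stack u v)"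
  for u v :: "real ^ 'd"
  by (metis norm_stack norm_fst_le)

lemma stack_eqI:
  assumes "\<And>i. w $ Inl i = u $ i" and "\<And>i. w $ Inr i = v $ i"
  shows "w = stack u v"
  using assms by (auto simp: vec_eq_iff stack_def split: sum.split)

lemma stack_add: "stack u v + stack u' v' = stack (u + u') (v + v')"
  by (rule stack_eqI) (simp_all add: stack_def)

lemma block_matrix_mult_stack:
  "block_matrix P Q S T *v stack u v = stack (P *v u + Q *v v) (S *v u + T *v v)"
  by (rule stack_eqI)
    (simp_all add: block_matrix_def stack_def matrix_vector_mult_def sum_UNIV_Plus)

lemma mat_mult_vector: "mat c *v u = c *s u"
  for u :: "'a::semiring_1 ^ 'd"
  by (simp add: vec_eq_iff matrix_vector_mult_def mat_def if_distrib[of "\<lambda>c. c * _"] sum.delta'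
      cong: if_cong)

lemma step_matrix_mult_stack:
  "step_matrix s \<beta> H *v stack u v = stack ((1 + \<beta>) *\<^sub>R u - \<beta> *\<^sub>R v - s *\<^sub>R (H *v u)) u"
proof -
  have "(mat (1 + \<beta>) - s *\<^sub>R H) *v u + mat (- \<beta>) *v v
      = (1 + \<beta>) *\<^sub>R u - \<beta> *\<^sub>R v - s *\<^sub>R (H *v u)"
    by (simp add: mat_mult_vector matrix_vector_mult_diff_rdistrib
        scaleR_matrix_vector_assoc[symmetric] scalar_mult_eq_scaleR)
  then show ?thesis
    by (simp add: step_matrix_def block_matrix_mult_stack)
qed

lemma noise_matrix_mult: "noise_matrix *v u = stack u 0"
proof (rule stack_eqI)
  fix i
  show "(noise_matrix *v u) $ Inl i = u $ i"
    using mat_mult_vector[of 1 u]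
    by (simp add: vec_eq_iff noise_matrix_def block_column_def matrix_vector_mult_def)
  show "(noise_matrix *v u) $ Inr i = 0 $ i"
    by (simp add: noise_matrix_def block_column_def matrix_vector_mult_def)
qed

section \<open>Operator norms and the noise gain\<close>

lemma norm_mult_le_opnorm: "norm (P *v v) \<le> opnorm P * norm v"
  unfolding opnorm_def by (rule onorm[OF matrix_vector_mul_bounded_linear])

lemma opnorm_nonneg: "0 \<le> opnorm P"
  unfolding opnorm_def by (rule onorm_pos_le[OF matrix_vector_mul_bounded_linear])

lemma opnorm_mult_le: "opnorm (P ** Q) \<le> opnorm P * opnorm Q"
proof -
  have "(*v) (P ** Q) = (*v) P \<circ> (*v) Q"
    by (simp add: fun_eq_iff matrix_vector_mul_assoc)
  then show ?thesis
    unfolding opnorm_def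
    using onorm_compose[OF matrix_vector_mul_bounded_linear matrix_vector_mul_bounded_linear]
    by metis
qed

lemma periodic_mod:
  fixes f :: "int \<Rightarrow> 'a"
  assumes "\<And>i. f (i + int m) = f i"
  shows "f (i mod int m) = f i"
proof -
  have up: "f (i + int k * int m) = f i" for i and k :: nat
  proof (induction k)
    case (Suc k)
    have "i + int (Suc k) * int m = (i + int k * int m) + int m"
      by (simp add: algebra_simps)
    then show ?case
      using assms Suc.IH by metis
  qed simp
  show ?thesis
  proof (cases "i div int m \<ge> 0")
    case True
    have "i = i mod int m + int (nat (i div int m)) * int m"
      using True by simp
    then show ?thesis
      using up by metis
  next
    case False
    have "i mod int m = i + int (nat (- (i div int m))) * int m"
      using False by (simp add: minus_div_mult_eq_mod[symmetric])
    then show ?thesis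
      using up by metis
  qed
qed

lemma transition_periodic:
  assumes "\<And>i. A (i + int m) = A i"
  shows "transition A (i + int m) k l = transition A i k l"
proof (induction k)
  case (Suc k)
  have "A (i + int m + int k) = A (i + int k)"
    using assms[of "i + int k"] by (simp add: algebra_simps)
  then show ?case
    using Suc.IH by simp
qed simp

text \<open>The inner suprema in \<^const>\<open>noise_gain\<close> are real-valued, so they dominate the partial sums once
  these are known to be bounded. Geometric decay bounds them by a geometric series.\<close>

lemma bdd_above_noise_sums:
  assumes decay: "\<And>k l. l \<le> k \<Longrightarrow> opnorm (transition A i k l) \<le> C * q ^ (k - l)"
    and "C \<ge> 0" and "0 < q" and "q < 1"
  shows "bdd_above ((\<lambda>k. \<Sum>i'=1..k. opnorm (transition A i k i' ** noise_matrix)) ` {1..})"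
proof (rule bdd_aboveI2)
  fix k :: nat assume "k \<in> {1..}"
  let ?b = "opnorm (noise_matrix :: real ^ 'a ^ ('a + 'a))"
  have "(\<Sum>i'=1..k. opnorm (transition A i k i' ** noise_matrix))
      \<le> (\<Sum>i'=1..k. C * q ^ (k - i') * ?b)"
    by (intro sum_mono order_trans[OF opnorm_mult_le] mult_right_mono decay opnorm_nonneg) auto
  also have "\<dots> = C * ?b * (\<Sum>i'=1..k. q ^ (k - i'))"
    by (simp add: sum_distrib_left mult_ac)
  also have "(\<Sum>i'=1..k. q ^ (k - i')) = (\<Sum>i<k. q ^ i)"
    by (rule sum.reindex_bij_witness[of _ "\<lambda>i. k - i" "\<lambda>i. k - i"]) auto
  also have "\<dots> \<le> 1 / (1 - q)"
    using assms(3,4) sum_le_suminf[of "\<lambda>i. q ^ i" "{..<k}"] suminf_geometric[of q]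
    by (simp add: summable_geometric)
  finally show "(\<Sum>i'=1..k. opnorm (transition A i k i' ** noise_matrix)) \<le> C * ?b * (1 / (1 - q))"
    using assms(2) opnorm_nonneg[of "noise_matrix :: real ^ 'a ^ ('a + 'a)"]
    by (simp add: mult_left_mono)
qed

text \<open>The maximum in \<^const>\<open>noise_gain\<close> runs over one period; every other phase reduces to one of
  these because the transition products inherit the periodicity of the step matrices.\<close>

lemma noise_sum_le_noise_gain:
  assumes period: "\<And>i. A (i + int m) = A i" and "m > 0" and "k \<ge> 1"
    and decay: "\<And>i k l. l \<le> k \<Longrightarrow> opnorm (transition A i k l) \<le> C * q ^ (k - l)"
    and "C \<ge> 0" and "0 < q" and "q < 1"
  shows "(\<Sum>i=1..k. opnorm (transition A j k i ** noise_matrix)) \<le> noise_gain A m"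
proof -
  define g where "g j k = (\<Sum>i=1..k. opnorm (transition A j k i ** noise_matrix))" for j k
  have "g (i + int m) k = g i k" for i
    unfolding g_def by (simp add: transition_periodic[of A m, OF period])
  then have "g j k = g (j mod int m) k"
    using periodic_mod[of "\<lambda>i. g i k" m j] by simp
  also have "\<dots> \<le> (SUP k\<in>{1..}. g (j mod int m) k)"
    unfolding g_def using assms(3)
    by (intro cSUP_upper bdd_above_noise_sums[OF decay] assms) auto
  also have "\<dots> \<le> (MAX j\<in>{0..<int m}. SUP k\<in>{1..}. g j k)"
    using assms(2) by (intro Max_ge) auto
  finally show ?thesis
    unfolding g_def noise_gain_def .
qed

section \<open>Shadowing of the orbit\<close>

text \<open>Variation of constants: the noise entering at time \<open>i\<close> is transported to time \<open>N\<close> by the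
  product of the later step matrices.\<close>

lemma duhamel_formula:
  assumes "\<And>k. k < N \<Longrightarrow> E (Suc k) = A (j + int k) *v E k + B *v z (Suc k)"
  shows "E N = transition A j N 0 *v E 0 + (\<Sum>i=1..N. (transition A j N i ** B) *v z i)"
  using assms
proof (induction N)
  case (Suc N)
  have "(\<Sum>i=1..N. (transition A j (Suc N) i ** B) *v z i)
      = A (j + int N) *v (\<Sum>i=1..N. (transition A j N i ** B) *v z i)"
    by (simp add: matrix_vector_mul_assoc matrix_mul_assoc vec.sum)
  then show ?case
    using Suc by (simp add: matrix_vector_right_distrib matrix_vector_mul_assoc matrix_mul_assoc)
qed simp

text \<open>A bootstrap: the linear recursion is available at time \<open>k\<close> only as long as the error is at
  most \<open>\<rho>\<close>, but the explicit solution over the times at which it was available bounds the next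
  error by \<open>\<rho>\<close> again.\<close>

lemma locally_linear_recursion_bounded:
  assumes lin: "\<And>k. k < n \<Longrightarrow> norm (E k) \<le> \<rho> \<Longrightarrow>
      E (Suc k) = A (j + int k) *v E k + B *v z (Suc k)"
    and hom: "\<And>k. opnorm (transition A j k 0) \<le> C"
    and gain: "\<And>k. (\<Sum>i=1..k. opnorm (transition A j k i ** B)) \<le> G"
    and E0: "norm (E 0) \<le> \<epsilon>"
    and z: "\<And>i. 1 \<le> i \<Longrightarrow> i \<le> n \<Longrightarrow> norm (z i) \<le> \<delta>"
    and "0 \<le> \<delta>" and small: "C * \<epsilon> + G * \<delta> \<le> \<rho>"
  shows "k \<le> n \<Longrightarrow> norm (E k) \<le> \<rho>"
proof (induction k rule: less_induct)
  case (less k)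
  have "E k = transition A j k 0 *v E 0 + (\<Sum>i=1..k. (transition A j k i ** B) *v z i)"
    using less lin by (intro duhamel_formula) auto
  also have "norm \<dots> \<le> norm (transition A j k 0 *v E 0)
      + (\<Sum>i=1..k. norm ((transition A j k i ** B) *v z i))"
    by (intro norm_triangle_mono order_refl norm_sum)
  also have "norm (transition A j k 0 *v E 0) \<le> C * \<epsilon>"
    using E0 order_trans[OF opnorm_nonneg hom]
    by (intro order_trans[OF norm_mult_le_opnorm] mult_mono hom) auto
  also have "(\<Sum>i=1..k. norm ((transition A j k i ** B) *v z i))
      \<le> (\<Sum>i=1..k. opnorm (transition A j k i ** B) * \<delta>)"
    using less.prems
    by (intro sum_mono order_trans[OF norm_mult_le_opnorm] mult_left_mono z opnorm_nonneg) auto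
  also have "\<dots> \<le> G * \<delta>"
    unfolding sum_distrib_right[symmetric] using \<open>0 \<le> \<delta>\<close> gain by (rule mult_right_mono[rotated])
  finally show ?case
    using small by simp
qed

text \<open>Subtracting the scaled orbit equation from the recursion leaves a linear recursion for the
  pair of consecutive errors wherever the gradient is affine. The bootstrap needs
  \<open>\<rho> \<le> r\<close>, so that an error of size \<open>\<rho> * R\<close> stays in the affine region.\<close>

lemma heavy_ball_shadows_orbit:
  fixes U :: "real ^ 'd \<Rightarrow> real" and x y :: "int \<Rightarrow> real ^ 'd"
  assumes diff: "\<forall>y. U differentiable (at y)"
    and orbit: "\<forall>i. x (i + 1) = (1 + \<beta>) *\<^sub>R x i - \<beta> *\<^sub>R x (i - 1) - s *\<^sub>R gradient U (x i)"
    and affine: "\<forall>i u. norm u \<le> r \<longrightarrow> gradient U (x i + u) = gradient U (x i) + H i *v u"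
    and rec: "\<And>k::nat. y (int k + 1) = (1 + \<beta>) *\<^sub>R y (int k) - \<beta> *\<^sub>R y (int k - 1)
        - s *\<^sub>R gradient (rescaled R U) (y (int k)) + z (k + 1)"
    and hom: "\<And>k. opnorm (transition (\<lambda>i. step_matrix s \<beta> (H i)) j k 0) \<le> C"
    and gain: "\<And>k. (\<Sum>i=1..k.
        opnorm (transition (\<lambda>i. step_matrix s \<beta> (H i)) j k i ** noise_matrix)) \<le> G"
    and init: "norm (y 0 - R *\<^sub>R x j, y (-1) - R *\<^sub>R x (j - 1)) \<le> \<epsilon> * R"
    and z: "\<And>i. 1 \<le> i \<Longrightarrow> i \<le> n \<Longrightarrow> norm (z i) \<le> \<delta> * R"
    and "R > 0" and "\<delta> \<ge> 0" and small: "C * \<epsilon> + G * \<delta> \<le> \<rho>" and "\<rho> \<le> r" and "k \<le> n"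
  shows "norm (y (int k) - R *\<^sub>R x (j + int k)) \<le> \<rho> * R"
proof -
  define e where "e i = y i - R *\<^sub>R x (j + i)" for i
  define E where "E k = stack (e (int k)) (e (int k - 1))" for k :: nat
  have "norm (E k) \<le> \<rho> * R"
  proof (rule locally_linear_recursion_bounded[OF _ hom gain _ z _ _ \<open>k \<le> n\<close>])
    fix i :: nat assume "norm (E i) \<le> \<rho> * R"
    then have "norm (e (int i)) \<le> r * R"
      using norm_le_norm_stack[of "e (int i)" "e (int i - 1)"] \<open>\<rho> \<le> r\<close> \<open>R > 0\<close>
        mult_right_mono[of \<rho> r R] unfolding E_def by linarith
    then have "gradient (rescaled R U) (y (int i))
        = R *\<^sub>R gradient U (x (j + int i)) + H (j + int i) *v e (int i)"
      unfolding e_def using affine by (intro gradient_rescaled_affine_near[OF diff \<open>R > 0\<close>]) auto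
    moreover have "R *\<^sub>R x (j + int i + 1) = (1 + \<beta>) *\<^sub>R (R *\<^sub>R x (j + int i))
        - \<beta> *\<^sub>R (R *\<^sub>R x (j + int i - 1)) - s *\<^sub>R (R *\<^sub>R gradient U (x (j + int i)))"
      unfolding orbit[rule_format, of "j + int i"]
      by (simp add: scaleR_diff_right mult.commute)
    moreover have "e (int i + 1) = y (int i + 1) - R *\<^sub>R x (j + int i + 1)"
      by (simp add: e_def add_ac)
    moreover have "y (int i) = e (int i) + R *\<^sub>R x (j + int i)"
      and "y (int i - 1) = e (int i - 1) + R *\<^sub>R x (j + int i - 1)"
      by (simp_all add: e_def add_diff_eq)
    ultimately have "e (int i + 1) = (1 + \<beta>) *\<^sub>R e (int i) - \<beta> *\<^sub>R e (int i - 1)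
        - s *\<^sub>R (H (j + int i) *v e (int i)) + z (i + 1)"
      using rec[of i] by (simp add: scaleR_add_right scaleR_diff_right)
    then show "E (Suc i) = step_matrix s \<beta> (H (j + int i)) *v E i + noise_matrix *v z (Suc i)"
      unfolding E_def by (simp add: step_matrix_mult_stack noise_matrix_mult stack_add add_ac)
  next
    show "norm (E 0) \<le> \<epsilon> * R"
      using init by (simp add: E_def e_def norm_stack)
    show "0 \<le> \<delta> * R"
      using \<open>R > 0\<close> \<open>\<delta> \<ge> 0\<close> by simp
    show "C * (\<epsilon> * R) + G * (\<delta> * R) \<le> \<rho> * R"
      using mult_right_mono[OF small, of R] \<open>R > 0\<close> by (simp add: algebra_simps)
  qed
  then show ?thesis
    using norm_le_norm_stack[of "e (int k)" "e (int k - 1)"] unfolding E_def e_def by linarith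
qed

section \<open>Consecutive orbit points are separated\<close>

lemma orbit_gap_le:
  assumes "\<And>i. x (i + int m) = x i" and "m > 0"
  shows "orbit_gap x m \<le> norm (x (i + 1) - x i)"
proof -
  have "x (i + int m + 1) = x (i + 1)" for i
    using assms(1)[of "i + 1"] by (simp add: algebra_simps)
  then have "norm (x (i + 1) - x i) = norm (x (i mod int m + 1) - x (i mod int m))"
    using periodic_mod[of "\<lambda>i. norm (x (i + 1) - x i)" m i] assms(1) by simp
  also have "\<dots> \<ge> orbit_gap x m"
    unfolding orbit_gap_def using assms(2) by (intro Min_le) auto
  finally show ?thesis .
qed

lemma orbit_gap_pos:
  assumes period: "\<And>i. x (i + int m) = x i" and inj: "inj_on x {0..<int m}" and "m \<ge> 2"
  shows "orbit_gap x m > 0"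
proof -
  have "x (i + 1) \<noteq> x i" if i: "i \<in> {0..<int m}" for i
  proof (cases "i + 1 < int m")
    case True
    then show ?thesis
      using inj_onD[OF inj, of "i + 1" i] i by auto
  next
    \<comment> \<open>the gap closing the cycle: \<open>m \<ge> 2\<close> separates the last point from the first\<close>
    case False
    then have "i = int m - 1"
      using i by simp
    moreover have "x (int m - 1) \<noteq> x 0"
      using inj_onD[OF inj, of "int m - 1" 0] \<open>m \<ge> 2\<close> by auto
    ultimately show ?thesis
      using period[of 0] by simp
  qed
  then show ?thesis
    unfolding orbit_gap_def using \<open>m \<ge> 2\<close> by (subst Min_gr_iff) auto
qed

section \<open>Good events and total variation\<close>

lemma prob_space_noisy_heavy_ball:
  "noisy_heavy_ball s \<beta> V M Y \<zeta> \<Longrightarrow> prob_space M"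
  unfolding noisy_heavy_ball_def by blast

lemma good_event_eq:
  assumes "n \<ge> 1"
  shows "good_event x R n \<epsilon> \<delta> j M Y \<zeta> = {\<omega> \<in> space M. norm (initial_error x R j Y \<omega>) \<le> \<epsilon> * R \<and>
    (\<forall>i\<in>{1..n}. norm (\<zeta> i \<omega>) \<le> \<delta> * R)}"
  using assms unfolding good_event_def by (auto simp: Max_le_iff)

lemma sets_good_event:
  assumes "noisy_heavy_ball s \<beta> V M Y \<zeta>" and "n \<ge> 1"
  shows "good_event x R n \<epsilon> \<delta> j M Y \<zeta> \<in> sets M"
proof -
  have [measurable]: "Y 0 \<in> borel_measurable M" "Y (-1) \<in> borel_measurable M"
    and z: "\<And>i. i \<in> {1..n} \<Longrightarrow> \<zeta> i \<in> borel_measurable M"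
    using assms(1) unfolding noisy_heavy_ball_def by auto
  have 1: "{\<omega> \<in> space M. norm (initial_error x R j Y \<omega>) \<le> \<epsilon> * R} \<in> sets M"
    unfolding initial_error_def norm_prod_def fst_conv snd_conv by measurable
  have 2: "{\<omega> \<in> space M. \<forall>i\<in>{1..n}. norm (\<zeta> i \<omega>) \<le> \<delta> * R} \<in> sets M"
    by (rule sets.sets_Collect_finite_All) (auto intro!: borel_measurable_le measurable_compose[OF z borel_measurable_norm])
  show ?thesis
    unfolding good_event_eq[OF assms(2)] using sets.Int[OF 1 2]
    by (rule back_subst[of "\<lambda>S. S \<in> sets M"]) auto
qed

lemma tv_dist_ge:
  assumes "prob_space \<mu>" and "prob_space \<nu>" and "S \<in> sets \<mu>"
  shows "measure \<mu> S - measure \<nu> S \<le> tv_dist \<mu> \<nu>"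
proof -
  interpret \<mu>: prob_space \<mu> by fact
  interpret \<nu>: prob_space \<nu> by fact
  have "\<bar>measure \<mu> S - measure \<nu> S\<bar> \<le> 1" for S
    using \<mu>.prob_le_1[of S] \<nu>.prob_le_1[of S] measure_nonneg[of \<mu> S] measure_nonneg[of \<nu> S]
    by linarith
  then have "bdd_above ((\<lambda>S. \<bar>measure \<mu> S - measure \<nu> S\<bar>) ` sets \<mu>)"
    by (intro bdd_aboveI2[of _ _ 1])
  then have "\<bar>measure \<mu> S - measure \<nu> S\<bar> \<le> tv_dist \<mu> \<nu>"
    unfolding tv_dist_def using assms(3) by (intro cSUP_upper)
  then show ?thesis
    by linarith
qed

text \<open>The test set is the preimage under \<open>f\<close> of the region \<open>S\<close> that confines the first variable: the
  first law charges it with at least the probability of \<open>G1\<close>. On \<open>G2\<close> the second variable is sent into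
  \<open>T\<close>, hence outside \<open>S\<close>, so the second law charges it with at most the probability of the complement
  of \<open>G2\<close>. Each variable uses only its own probability space.\<close>

lemma tv_dist_ge_of_disjoint_confinement:
  assumes M1: "prob_space M1" and M2: "prob_space M2"
    and Z1: "Z1 \<in> measurable M1 N" and Z2: "Z2 \<in> measurable M2 N"
    and f: "f \<in> measurable N L" and S: "S \<in> sets L" and disj: "S \<inter> T = {}"
    and G1: "G1 \<in> sets M1" and G2: "G2 \<in> sets M2"
    and in1: "\<And>\<omega>. \<omega> \<in> G1 \<Longrightarrow> f (Z1 \<omega>) \<in> S" and in2: "\<And>\<omega>. \<omega> \<in> G2 \<Longrightarrow> f (Z2 \<omega>) \<in> T"
  shows "1 - measure M1 (space M1 - G1) - measure M2 (space M2 - G2)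
    \<le> tv_dist (distr M1 N Z1) (distr M2 N Z2)"
proof -
  interpret M1: prob_space M1 by fact
  interpret M2: prob_space M2 by fact
  let ?S = "f -` S \<inter> space N"
  have S': "?S \<in> sets N"
    using f S by (rule measurable_sets)
  have sp1: "G1 \<subseteq> space M1" and sp2: "G2 \<subseteq> space M2"
    using G1 G2 sets.sets_into_space by auto
  have "1 - measure M1 (space M1 - G1) = measure M1 G1"
    using M1.prob_compl[OF G1] by simp
  also have "\<dots> \<le> measure (distr M1 N Z1) ?S"
    unfolding measure_distr[OF Z1 S']
    using in1 sp1 measurable_space[OF Z1] measurable_sets[OF Z1 S']
    by (intro M1.finite_measure_mono) auto
  finally have 1: "1 - measure M1 (space M1 - G1) \<le> measure (distr M1 N Z1) ?S" .
  have 2: "measure (distr M2 N Z2) ?S \<le> measure M2 (space M2 - G2)"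
    unfolding measure_distr[OF Z2 S']
    using in2 disj sp2 G2 by (intro M2.finite_measure_mono) auto
  have "measure (distr M1 N Z1) ?S - measure (distr M2 N Z2) ?S
      \<le> tv_dist (distr M1 N Z1) (distr M2 N Z2)"
    using S' by (intro tv_dist_ge M1.prob_space_distr M2.prob_space_distr Z1 Z2) auto
  then show ?thesis
    using 1 2 by linarith
qed

text \<open>With a vanishing initial error the good event can fail only through one of the \<open>n\<close> noise
  variables being large, which a union bound controls.\<close>

lemma measure_compl_good_event_le:
  assumes hb: "noisy_heavy_ball s \<beta> V M Y \<zeta>" and "n \<ge> 1" and "\<epsilon> * R \<ge> 0"
    and init: "\<forall>\<omega>\<in>space M. initial_error x R j Y \<omega> = 0"
    and sup: "(SUP i\<in>{1..}. measure M {\<omega>\<in>space M. norm (\<zeta> i \<omega>) > \<delta> * R}) \<le> p"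
  shows "measure M (space M - good_event x R n \<epsilon> \<delta> j M Y \<zeta>) \<le> real n * p"
proof -
  interpret prob_space M
    using hb by (rule prob_space_noisy_heavy_ball)
  let ?B = "\<lambda>i. {\<omega>\<in>space M. norm (\<zeta> i \<omega>) > \<delta> * R}"
  have B: "?B i \<in> sets M" if "i \<in> {1..n}" for i
    using hb that unfolding noisy_heavy_ball_def
    by (intro borel_measurable_less borel_measurable_const borel_measurable_norm) auto
  have p: "measure M (?B i) \<le> p" if "i \<in> {1..n}" for i
    using that by (intro order_trans[OF cSUP_upper sup] bdd_aboveI2[of _ _ 1]) auto
  have "space M - good_event x R n \<epsilon> \<delta> j M Y \<zeta> \<subseteq> (\<Union>i\<in>{1..n}. ?B i)"
    using init \<open>\<epsilon> * R \<ge> 0\<close> unfolding good_event_eq[OF \<open>n \<ge> 1\<close>] by (auto simp: not_le)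
  then have "measure M (space M - good_event x R n \<epsilon> \<delta> j M Y \<zeta>) \<le> measure M (\<Union>i\<in>{1..n}. ?B i)"
    using B by (intro finite_measure_mono sets.finite_UN) auto
  also have "\<dots> \<le> (\<Sum>i\<in>{1..n}. measure M (?B i))"
    using B by (intro finite_measure_subadditive_finite) auto
  also have "\<dots> \<le> (\<Sum>i\<in>{1..n}. p)"
    using p by (rule sum_mono)
  finally show ?thesis
    by simp
qed

section \<open>Separation of consecutive laws\<close>

theorem lemma4p4:
  fixes s \<beta> r\<^sub>0 C q R \<epsilon>\<^sub>0 \<delta> :: real
    and m n :: nat
    and j :: int
    and U :: "real ^ 'd::finite \<Rightarrow> real"
    and x :: "int \<Rightarrow> real ^ 'd"
    and H :: "int \<Rightarrow> real ^ 'd ^ 'd"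
    and A :: "int \<Rightarrow> real ^ ('d + 'd) ^ ('d + 'd)"
    and G\<^sub>0 a :: real
    and M :: "'w measure"
    and Y :: "int \<Rightarrow> 'w \<Rightarrow> real ^ 'd"
    and \<zeta> :: "nat \<Rightarrow> 'w \<Rightarrow> real ^ 'd"
  assumes "s > 0" and "0 < \<beta>" and "\<beta> < 1" and "m \<ge> 2"
    and "\<forall>y. U differentiable (at y)"
    \<comment> \<open>periodic orbit and local gradient identity\<close>
    and "\<forall>i. x (i + int m) = x i"
    and "inj_on x {0..<int m}"
    and "\<forall>i. H (i + int m) = H i"
    and "\<forall>i. transpose (H i) = H i"
    and "r\<^sub>0 > 0"
    and "\<forall>i. x (i + 1) = (1 + \<beta>) *\<^sub>R x i - \<beta> *\<^sub>R x (i - 1) - s *\<^sub>R gradient U (x i)"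
    and "\<forall>i u. norm u \<le> r\<^sub>0 \<longrightarrow> gradient U (x i + u) = gradient U (x i) + H i *v u"
    \<comment> \<open>spectral radius condition and derived constants\<close>
    and "A = (\<lambda>i. step_matrix s \<beta> (H i))"
    and "spectral_radius (transition A 0 m 0) < 1"
    and "C \<ge> 1" and "0 < q" and "q < 1"
    and "\<forall>i k l. l \<le> k \<longrightarrow> opnorm (transition A i k l) \<le> C * q ^ (k - l)"
    and "G\<^sub>0 = noise_gain A m"
    and "a = tube_radius x m r\<^sub>0"
    \<comment> \<open>the noisy recursion\<close>
    and "R \<ge> 1" and "n \<ge> 1" and "\<epsilon>\<^sub>0 \<ge> 0" and "\<delta> > 0"
    and "noisy_heavy_ball s \<beta> (rescaled R U) M Y \<zeta>"
    and "C * \<epsilon>\<^sub>0 + G\<^sub>0 * \<delta> \<le> a / 2"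
  shows
    "(\<forall>\<omega> \<in> good_event x R n \<epsilon>\<^sub>0 \<delta> j M Y \<zeta>. \<forall>k\<le>n.
        norm (Y (int k) \<omega> - R *\<^sub>R x (j + int k)) \<le> a * R / 2)
     \<and>
     (\<forall>(M\<^sub>1 :: 'w1 measure) Y\<^sub>1 \<zeta>\<^sub>1 (M\<^sub>2 :: 'w2 measure) Y\<^sub>2 \<zeta>\<^sub>2.
        noisy_heavy_ball s \<beta> (rescaled R U) M\<^sub>1 Y\<^sub>1 \<zeta>\<^sub>1 \<and>
        noisy_heavy_ball s \<beta> (rescaled R U) M\<^sub>2 Y\<^sub>2 \<zeta>\<^sub>2 \<longrightarrow>
        tv_dist (distr M\<^sub>1 borel (Y\<^sub>1 (int n))) (distr M\<^sub>2 borel (Y\<^sub>2 (int n)))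
          \<ge> 1 - measure M\<^sub>1 (space M\<^sub>1 - good_event x R n \<epsilon>\<^sub>0 \<delta> j M\<^sub>1 Y\<^sub>1 \<zeta>\<^sub>1)
              - measure M\<^sub>2 (space M\<^sub>2 - good_event x R n \<epsilon>\<^sub>0 \<delta> (j + 1) M\<^sub>2 Y\<^sub>2 \<zeta>\<^sub>2) \<and>
        (\<forall>(N :: 'z measure) Z\<^sub>1 Z\<^sub>2 f.
           Z\<^sub>1 \<in> measurable M\<^sub>1 N \<and> Z\<^sub>2 \<in> measurable M\<^sub>2 N \<and> f \<in> borel_measurable N \<and>
           (\<forall>\<omega>\<in>space M\<^sub>1. Y\<^sub>1 (int n) \<omega> = f (Z\<^sub>1 \<omega>)) \<and>
           (\<forall>\<omega>\<in>space M\<^sub>2. Y\<^sub>2 (int n) \<omega> = f (Z\<^sub>2 \<omega>)) \<longrightarrow>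
           tv_dist (distr M\<^sub>1 N Z\<^sub>1) (distr M\<^sub>2 N Z\<^sub>2)
             \<ge> 1 - measure M\<^sub>1 (space M\<^sub>1 - good_event x R n \<epsilon>\<^sub>0 \<delta> j M\<^sub>1 Y\<^sub>1 \<zeta>\<^sub>1)
                 - measure M\<^sub>2 (space M\<^sub>2 - good_event x R n \<epsilon>\<^sub>0 \<delta> (j + 1) M\<^sub>2 Y\<^sub>2 \<zeta>\<^sub>2)))
     \<and>
     (\<forall>A' b. A' > 0 \<and> b > 0 \<longrightarrow>
        ((\<forall>\<omega>\<in>space M. initial_error x R j Y \<omega> = 0) \<and>
         (SUP i\<in>{1..}. measure M {\<omega>\<in>space M. norm (\<zeta> i \<omega>) > \<delta> * R}) \<le> A' * exp (- b * R\<^sup>2) \<longrightarrow>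
           measure M (space M - good_event x R n \<epsilon>\<^sub>0 \<delta> j M Y \<zeta>) \<le> A' * n * exp (- b * R\<^sup>2))
        \<and>
        (\<forall>(M\<^sub>1 :: 'w1 measure) Y\<^sub>1 \<zeta>\<^sub>1 (M\<^sub>2 :: 'w2 measure) Y\<^sub>2 \<zeta>\<^sub>2.
           noisy_heavy_ball s \<beta> (rescaled R U) M\<^sub>1 Y\<^sub>1 \<zeta>\<^sub>1 \<and>
           noisy_heavy_ball s \<beta> (rescaled R U) M\<^sub>2 Y\<^sub>2 \<zeta>\<^sub>2 \<and>
           (\<forall>\<omega>\<in>space M\<^sub>1. initial_error x R j Y\<^sub>1 \<omega> = 0) \<and>
           (\<forall>\<omega>\<in>space M\<^sub>2. initial_error x R (j + 1) Y\<^sub>2 \<omega> = 0) \<and>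
           (SUP i\<in>{1..}. measure M\<^sub>1 {\<omega>\<in>space M\<^sub>1. norm (\<zeta>\<^sub>1 i \<omega>) > \<delta> * R}) \<le> A' * exp (- b * R\<^sup>2) \<and>
           (SUP i\<in>{1..}. measure M\<^sub>2 {\<omega>\<in>space M\<^sub>2. norm (\<zeta>\<^sub>2 i \<omega>) > \<delta> * R}) \<le> A' * exp (- b * R\<^sup>2) \<longrightarrow>
           tv_dist (distr M\<^sub>1 borel (Y\<^sub>1 (int n))) (distr M\<^sub>2 borel (Y\<^sub>2 (int n)))
             \<ge> 1 - 2 * A' * n * exp (- b * R\<^sup>2)))"
proof -
  note period_x = assms(6) and A_def = assms(13)
  have "R > 0" and "m > 0"
    using \<open>R \<ge> 1\<close> \<open>m \<ge> 2\<close> by auto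
  have "\<epsilon>\<^sub>0 * R \<ge> 0"
    using \<open>R > 0\<close> \<open>\<epsilon>\<^sub>0 \<ge> 0\<close> by simp
  have gap: "orbit_gap x m > 0"
    using assms(4,6,7) by (intro orbit_gap_pos) auto
  then have "a > 0"
    unfolding assms(20) tube_radius_def using \<open>r\<^sub>0 > 0\<close> by simp
  have "4 * a \<le> r\<^sub>0" and a_gap: "4 * a \<le> orbit_gap x m"
    unfolding assms(20) tube_radius_def by auto
  have period_A: "A (i + int m) = A i" for i
    unfolding A_def using assms(8) by simp
  have decay: "opnorm (transition A i k l) \<le> C * q ^ (k - l)" if "l \<le> k" for i k l
    using assms(18) that by blast
  have hom: "opnorm (transition A i k 0) \<le> C" for i k
    using decay[of 0 k i] mult_left_mono[of "q ^ k" 1 C] power_le_one[of q k]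
      \<open>C \<ge> 1\<close> \<open>0 < q\<close> \<open>q < 1\<close> by (simp add: order_trans)
  have gain1: "(\<Sum>i'=1..k. opnorm (transition A i k i' ** noise_matrix)) \<le> G\<^sub>0" if "k \<ge> 1" for i k
    unfolding assms(19)
    using \<open>m > 0\<close> that \<open>C \<ge> 1\<close> \<open>0 < q\<close> \<open>q < 1\<close>
    by (intro noise_sum_le_noise_gain[OF period_A _ _ decay]) auto
  have gain: "(\<Sum>i'=1..k. opnorm (transition A i k i' ** noise_matrix)) \<le> G\<^sub>0" for i k
  proof (cases "k = 0")
    \<comment> \<open>the supremum starts at \<open>k = 1\<close>; the empty sum is covered by \<open>G\<^sub>0 \<ge> 0\<close>\<close>
    case True
    have "0 \<le> (\<Sum>i'=1..1. opnorm (transition A i 1 i' ** noise_matrix))"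
      by (intro sum_nonneg opnorm_nonneg)
    then show ?thesis
      using gain1[of 1 i] True by simp
  qed (use gain1 in auto)
  have shadow: "norm (Y' (int k) \<omega> - R *\<^sub>R x (i + int k)) \<le> a * R / 2"
    if hb: "noisy_heavy_ball s \<beta> (rescaled R U) M' Y' \<zeta>'"
      and \<omega>: "\<omega> \<in> good_event x R n \<epsilon>\<^sub>0 \<delta> i M' Y' \<zeta>'" and "k \<le> n"
    for M' :: "'v measure" and Y' \<zeta>' \<omega> i k
  proof -
    have "norm (Y' (int k) \<omega> - R *\<^sub>R x (i + int k)) \<le> (a / 2) * R"
    proof (rule heavy_ball_shadows_orbit[OF assms(5,11,12), where z = "\<lambda>k. \<zeta>' k \<omega>"])
      show "Y' (int k + 1) \<omega> = (1 + \<beta>) *\<^sub>R Y' (int k) \<omega> - \<beta> *\<^sub>R Y' (int k - 1) \<omega>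
          - s *\<^sub>R gradient (rescaled R U) (Y' (int k) \<omega>) + \<zeta>' (k + 1) \<omega>" for k
        using hb \<omega> unfolding noisy_heavy_ball_def good_event_def by blast
    qed (use \<omega> hom gain assms(26) \<open>a > 0\<close> \<open>4 * a \<le> r\<^sub>0\<close> \<open>R > 0\<close> \<open>\<delta> > 0\<close> \<open>k \<le> n\<close> in
        \<open>auto simp: A_def good_event_eq[OF \<open>n \<ge> 1\<close>] initial_error_def\<close>)
    then show ?thesis
      by simp
  qed
  define tube where "tube i = cball (R *\<^sub>R x i) (a * R / 2)" for i
  have disj: "tube i \<inter> tube (i + 1) = {}" for i
  proof -
    have "a * R < R * (4 * a)"
      using \<open>a > 0\<close> \<open>R > 0\<close> by simp
    also have "\<dots> \<le> R * norm (x (i + 1) - x i)"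
      using a_gap orbit_gap_le[of x m i] period_x \<open>m > 0\<close> \<open>R > 0\<close> by (intro mult_left_mono) force+
    also have "\<dots> = dist (R *\<^sub>R x i) (R *\<^sub>R x (i + 1))"
      using \<open>R > 0\<close>
      by (simp add: dist_norm scaleR_diff_right[symmetric] norm_minus_commute)
    finally show ?thesis
      unfolding tube_def by (intro disjoint_cballI) (simp add: mult.commute)
  qed
  have in_tube: "Y' (int n) \<omega> \<in> tube (i + int n)"
    if "noisy_heavy_ball s \<beta> (rescaled R U) M' Y' \<zeta>'"
      and "\<omega> \<in> good_event x R n \<epsilon>\<^sub>0 \<delta> i M' Y' \<zeta>'"
    for M' :: "'v measure" and Y' \<zeta>' \<omega> i
    using shadow[OF that order_refl] unfolding tube_def by (simp add: dist_norm norm_minus_commute)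
  have tv: "1 - measure M1 (space M1 - good_event x R n \<epsilon>\<^sub>0 \<delta> j M1 Y1 \<zeta>1)
        - measure M2 (space M2 - good_event x R n \<epsilon>\<^sub>0 \<delta> (j + 1) M2 Y2 \<zeta>2)
      \<le> tv_dist (distr M1 N Z1) (distr M2 N Z2)"
    if hb1: "noisy_heavy_ball s \<beta> (rescaled R U) M1 Y1 \<zeta>1"
      and hb2: "noisy_heavy_ball s \<beta> (rescaled R U) M2 Y2 \<zeta>2"
      and Z1: "Z1 \<in> measurable M1 N" and Z2: "Z2 \<in> measurable M2 N"
      and f: "f \<in> borel_measurable N"
      and Y1: "\<forall>\<omega>\<in>space M1. Y1 (int n) \<omega> = f (Z1 \<omega>)"
      and Y2: "\<forall>\<omega>\<in>space M2. Y2 (int n) \<omega> = f (Z2 \<omega>)"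
    for M1 :: "'v1 measure" and M2 :: "'v2 measure" and N :: "'y measure"
      and Y1 Y2 \<zeta>1 \<zeta>2 Z1 Z2 f
  proof (rule tv_dist_ge_of_disjoint_confinement[OF prob_space_noisy_heavy_ball[OF hb1]
        prob_space_noisy_heavy_ball[OF hb2] Z1 Z2 f _ disj
        sets_good_event[OF hb1 \<open>n \<ge> 1\<close>] sets_good_event[OF hb2 \<open>n \<ge> 1\<close>]])
    show "tube (j + int n) \<in> sets borel"
      unfolding tube_def by simp
  next
    fix \<omega> assume "\<omega> \<in> good_event x R n \<epsilon>\<^sub>0 \<delta> j M1 Y1 \<zeta>1"
    then show "f (Z1 \<omega>) \<in> tube (j + int n)"
      using in_tube[OF hb1] Y1 unfolding good_event_def by auto
  next
    fix \<omega> assume "\<omega> \<in> good_event x R n \<epsilon>\<^sub>0 \<delta> (j + 1) M2 Y2 \<zeta>2"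
    then have "Y2 (int n) \<omega> \<in> tube (j + 1 + int n)" and "\<omega> \<in> space M2"
      using in_tube[OF hb2] unfolding good_event_def by auto
    moreover have "j + 1 + int n = j + int n + 1"
      by simp
    ultimately show "f (Z2 \<omega>) \<in> tube (j + int n + 1)"
      using Y2 by metis
  qed
  have tvY: "1 - measure M1 (space M1 - good_event x R n \<epsilon>\<^sub>0 \<delta> j M1 Y1 \<zeta>1)
        - measure M2 (space M2 - good_event x R n \<epsilon>\<^sub>0 \<delta> (j + 1) M2 Y2 \<zeta>2)
      \<le> tv_dist (distr M1 borel (Y1 (int n))) (distr M2 borel (Y2 (int n)))"
    if "noisy_heavy_ball s \<beta> (rescaled R U) M1 Y1 \<zeta>1"
      and "noisy_heavy_ball s \<beta> (rescaled R U) M2 Y2 \<zeta>2"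
    for M1 :: "'v1 measure" and M2 :: "'v2 measure" and Y1 Y2 \<zeta>1 \<zeta>2
    by (rule tv[OF that _ _ measurable_ident]) (use that in \<open>auto simp: noisy_heavy_ball_def\<close>)
  note tail = measure_compl_good_event_le[OF _ \<open>n \<ge> 1\<close> \<open>\<epsilon>\<^sub>0 * R \<ge> 0\<close>]
  show ?thesis
  proof (intro conjI allI impI ballI; (elim conjE)?)
    fix \<omega> k assume "\<omega> \<in> good_event x R n \<epsilon>\<^sub>0 \<delta> j M Y \<zeta>" "k \<le> n"
    then show "norm (Y (int k) \<omega> - R *\<^sub>R x (j + int k)) \<le> a * R / 2"
      using shadow[OF assms(25)] by blast
  next
    fix A' b :: real
    assume "\<forall>\<omega>\<in>space M. initial_error x R j Y \<omega> = 0"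
      and "(SUP i\<in>{1..}. measure M {\<omega>\<in>space M. norm (\<zeta> i \<omega>) > \<delta> * R}) \<le> A' * exp (- b * R\<^sup>2)"
    from tail[OF assms(25) this]
    show "measure M (space M - good_event x R n \<epsilon>\<^sub>0 \<delta> j M Y \<zeta>) \<le> A' * n * exp (- b * R\<^sup>2)"
      by (simp add: mult_ac)
  next
    fix A' b :: real
      and M1 :: "'w1 measure" and Y1 \<zeta>1 and M2 :: "'w2 measure" and Y2 \<zeta>2
    assume hb1: "noisy_heavy_ball s \<beta> (rescaled R U) M1 Y1 \<zeta>1"
      and hb2: "noisy_heavy_ball s \<beta> (rescaled R U) M2 Y2 \<zeta>2"
      and "\<forall>\<omega>\<in>space M1. initial_error x R j Y1 \<omega> = 0"
      and "\<forall>\<omega>\<in>space M2. initial_error x R (j + 1) Y2 \<omega> = 0"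
      and "(SUP i\<in>{1..}. measure M1 {\<omega>\<in>space M1. norm (\<zeta>1 i \<omega>) > \<delta> * R})
        \<le> A' * exp (- b * R\<^sup>2)"
      and "(SUP i\<in>{1..}. measure M2 {\<omega>\<in>space M2. norm (\<zeta>2 i \<omega>) > \<delta> * R})
        \<le> A' * exp (- b * R\<^sup>2)"
    then have "measure M1 (space M1 - good_event x R n \<epsilon>\<^sub>0 \<delta> j M1 Y1 \<zeta>1)
          \<le> real n * (A' * exp (- b * R\<^sup>2))"
      and "measure M2 (space M2 - good_event x R n \<epsilon>\<^sub>0 \<delta> (j + 1) M2 Y2 \<zeta>2)
          \<le> real n * (A' * exp (- b * R\<^sup>2))"
      using tail[OF hb1] tail[OF hb2] by blast+
    moreover have "2 * A' * n * exp (- b * R\<^sup>2)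
        = real n * (A' * exp (- b * R\<^sup>2)) + real n * (A' * exp (- b * R\<^sup>2))"
      by (simp add: algebra_simps)
    ultimately show "tv_dist (distr M1 borel (Y1 (int n))) (distr M2 borel (Y2 (int n)))
        \<ge> 1 - 2 * A' * n * exp (- b * R\<^sup>2)"
      using tvY[OF hb1 hb2] by linarith
  qed (fact tvY tv)+
qed

end
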